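(* For any $1\le d\le n$, there is a linear ideal $I$ in $\mathbb{C}[x_1,\ldots,x_n]$, generated by $d$ linear forms $\sum_{j=1}^n a_{ij}x_j$ ($i=1,\ldots,d$) with $(a_{ij})$ an integer $d\times n$ matrix of rank $d$, such that any tropical basis of $I$ consisting of linear forms in $I$ has size at least $\frac{1}{n-d+1}\binom{n}{d}$.
   Context: For $f\in\mathbb{C}[x_1,\ldots,x_n]$ and $w\in\mathbb{R}^n$, the initial form $\mathrm{in}_w(f)$ is the sum of all terms $c\,x^u$ of $f$ of lowest $w$-weight $w\cdot u$ (and $\mathrm{in}_w(0)=0$). A monomial here means a single term, up to a nonzero scalar. The tropical hypersurface of $f$ is $\mathcal{T}(f)=\{w\in\mathbb{R}^n:\mathrm{in}_w(f)\text{ is not a monomial}\}$. For an ideal $I$, the tropical variety is $\mathcal{T}(I)=\bigcap_{f\in I}\mathcal{T}(f)$. A tropical basis of $I$ is a finite set $\{f_1,\ldots,f_t\}$ with $\langle f_1,\ldots,f_t\rangle=I$ and $\mathcal{T}(I)=\mathcal{T}(f_1)\cap\cdots\cap\mathcal{T}(f_t)$. *)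

theory Defs
  imports "HOL-Analysis.Analysis" "HOL-Library.Poly_Mapping"
begin

text \<open>
  The polynomial ring in the variables \<open>x\<^sub>i\<close>, for \<open>i\<close> in a finite index type:
  an exponent vector is a finitely supported map \<open>'n \<Rightarrow>\<^sub>0 nat\<close>, and a polynomial is a
  finitely supported map from exponent vectors to coefficients, multiplied by convolution.
\<close>
type_synonym 'n cpoly = "('n \<Rightarrow>\<^sub>0 nat) \<Rightarrow>\<^sub>0 complex"

text \<open>
  A commutative ring as a module over itself: \<open>ideal.subspace I\<close> says that \<open>I\<close> is an
  ideal, and \<open>ideal.span F\<close> is the ideal generated by \<open>F\<close>.
\<close>
global_interpretation ideal: module "(*) :: 'a::comm_ring_1 \<Rightarrow> 'a \<Rightarrow> 'a"
  by standard (simp_all add: algebra_simps)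

definition weight :: "real ^ 'n \<Rightarrow> ('n::finite \<Rightarrow>\<^sub>0 nat) \<Rightarrow> real" where
  "weight w u = (\<Sum>i\<in>UNIV. w $ i * real (Poly_Mapping.lookup u i))"

definition initial_form :: "real ^ 'n \<Rightarrow> 'n::finite cpoly \<Rightarrow> 'n cpoly" where
  "initial_form w f =
     (\<Sum>u \<in> {u \<in> Poly_Mapping.keys f. \<forall>v \<in> Poly_Mapping.keys f. weight w u \<le> weight w v}.
        Poly_Mapping.single u (Poly_Mapping.lookup f u))"

text \<open>The zero polynomial is not a monomial, hence \<open>tropical_hypersurface 0 = UNIV\<close>.\<close>
definition is_monomial :: "'n cpoly \<Rightarrow> bool" where
  "is_monomial f \<longleftrightarrow> (\<exists>u c. c \<noteq> 0 \<and> f = Poly_Mapping.single u c)"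

definition tropical_hypersurface :: "'n::finite cpoly \<Rightarrow> (real ^ 'n) set" where
  "tropical_hypersurface f = {w. \<not> is_monomial (initial_form w f)}"

definition tropical_variety :: "'n::finite cpoly set \<Rightarrow> (real ^ 'n) set" where
  "tropical_variety I = (\<Inter>f\<in>I. tropical_hypersurface f)"

definition is_tropical_basis :: "'n::finite cpoly set \<Rightarrow> 'n cpoly set \<Rightarrow> bool" where
  "is_tropical_basis I F \<longleftrightarrow>
     finite F \<and> ideal.span F = I \<and> tropical_variety I = (\<Inter>f\<in>F. tropical_hypersurface f)"

definition var :: "'n \<Rightarrow> 'n cpoly" where
  "var j = Poly_Mapping.single (Poly_Mapping.single j 1) 1"

definition linear_form :: "complex ^ 'n \<Rightarrow> 'n::finite cpoly" where
  "linear_form a = (\<Sum>j\<in>UNIV. Poly_Mapping.single 0 (a $ j) * var j)"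

end

theory Submission
  imports Defs "HOL-Computational_Algebra.Polynomial"
begin

text \<open>
  Take for the rows of the matrix the powers \<open>t\<^sup>0, \<dots>, t\<^bsup>d-1\<^esup>\<close> of a vector \<open>t\<close> of distinct
  integers, so that the row space consists of the value vectors of the polynomials of degree less
  than \<open>d\<close>, and a nonzero such vector has at most \<open>d - 1\<close> zeros. For a set \<open>K\<close> of \<open>d\<close> indices let
  \<open>w\<close> be the indicator vector of the complement of \<open>K\<close>. The initial form of a linear form at \<open>w\<close>
  is a monomial iff its support meets \<open>K\<close> in exactly one index \<open>k\<close>; for a linear form in the ideal
  this forces its zero set to be exactly \<open>K - {k}\<close>. By interpolation such a form exists for every
  \<open>K\<close>, so \<open>w\<close> is not in the tropical variety and a tropical basis must contain such a form. But a
  form with zero set \<open>Z\<close> of size \<open>d - 1\<close> serves only the \<open>n - d + 1\<close> sets \<open>K\<close> of the shape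
  \<open>insert k Z\<close>.
\<close>

section \<open>Linear forms\<close>

lemma lookup_linear_form:
  "Poly_Mapping.lookup (linear_form a) u =
     (\<Sum>j\<in>UNIV. a $ j when Poly_Mapping.single j 1 = u)"
  by (simp add: linear_form_def var_def mult_single lookup_sum lookup_single)

lemma single_one_eq_iff:
  "Poly_Mapping.single i (1::nat) = Poly_Mapping.single j 1 \<longleftrightarrow> i = j"
  by (metis lookup_single_eq lookup_single_not_eq one_neq_zero)

lemma lookup_linear_form_single [simp]:
  "Poly_Mapping.lookup (linear_form a) (Poly_Mapping.single j 1) = a $ j"
  unfolding lookup_linear_form single_one_eq_iff by (simp add: when_def)

lemma lookup_linear_form_zero [simp]: "Poly_Mapping.lookup (linear_form a) 0 = 0"
proof -
  have "Poly_Mapping.single j (1::nat) \<noteq> 0" for j :: 'a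
    by (metis lookup_single_eq lookup_zero one_neq_zero)
  then show ?thesis by (simp add: lookup_linear_form)
qed

lemma keys_linear_form:
  "Poly_Mapping.keys (linear_form a) = (\<lambda>j. Poly_Mapping.single j 1) ` {j. a $ j \<noteq> 0}"
proof (intro equalityI subsetI)
  fix u assume "u \<in> Poly_Mapping.keys (linear_form a)"
  then have "(\<Sum>j\<in>UNIV. a $ j when Poly_Mapping.single j 1 = u) \<noteq> 0"
    by (simp add: in_keys_iff lookup_linear_form)
  then obtain j where "(a $ j when Poly_Mapping.single j 1 = u) \<noteq> 0"
    by (meson sum.not_neutral_contains_not_neutral)
  then show "u \<in> (\<lambda>j. Poly_Mapping.single j 1) ` {j. a $ j \<noteq> 0}"
    by (auto simp: when_def split: if_splits)
qed (auto simp: in_keys_iff simp del: One_nat_def)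

lemma weight_single [simp]: "weight w (Poly_Mapping.single j 1) = w $ j"
proof -
  have "w $ i * real (Poly_Mapping.lookup (Poly_Mapping.single j 1) i) = (if i = j then w $ i else 0)" for i
    by (auto simp: lookup_single when_def)
  then show ?thesis unfolding weight_def by simp
qed

lemma linear_form_add: "linear_form (a + b) = linear_form a + linear_form b"
  by (simp add: linear_form_def single_add distrib_right sum.distrib)

lemma linear_form_scale: "linear_form (c *s a) = Poly_Mapping.single 0 c * linear_form a"
  by (simp add: linear_form_def sum_distrib_left mult.assoc[symmetric] mult_single)

lemma lookup_single_zero_mult:
  fixes p :: "('a \<Rightarrow>\<^sub>0 nat) \<Rightarrow>\<^sub>0 'b::comm_ring_1"
  shows "Poly_Mapping.lookup (Poly_Mapping.single 0 c * p) u = c * Poly_Mapping.lookup p u"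
  by (simp add: mult_map_scale_conv_mult[symmetric] map.rep_eq when_def)

lemma lookup_mult_zero:
  fixes g p :: "('a \<Rightarrow>\<^sub>0 nat) \<Rightarrow>\<^sub>0 'b::comm_ring_1"
  assumes "Poly_Mapping.lookup p 0 = 0"
  shows "Poly_Mapping.lookup (g * p) 0 = 0"
proof (rule ccontr)
  assume "\<not> ?thesis"
  then have "0 \<in> Poly_Mapping.keys (g * p)" by (simp add: in_keys_iff)
  then obtain a b where ab: "0 = a + b" "b \<in> Poly_Mapping.keys p"
    using keys_mult[of g p] by blast
  have "b = 0"
    by (rule poly_mapping_eqI) (metis ab(1) add_is_0 lookup_add lookup_zero)
  with ab assms show False by (simp add: in_keys_iff)
qed

text \<open>An exponent vector of total degree one splits only as itself plus \<open>0\<close>. As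
  \<open>p\<close> has no constant term, multiplication by \<open>g\<close> acts on linear parts as
  scaling by the constant term of \<open>g\<close>.\<close>

lemma lookup_mult_single_one:
  fixes g p :: "('a \<Rightarrow>\<^sub>0 nat) \<Rightarrow>\<^sub>0 'b::comm_ring_1"
  assumes p: "Poly_Mapping.lookup p 0 = 0"
  shows "Poly_Mapping.lookup (g * p) (Poly_Mapping.single j 1) =
         Poly_Mapping.lookup g 0 * Poly_Mapping.lookup p (Poly_Mapping.single j 1)"
proof -
  \<comment> \<open>Neither \<open>h\<close> nor \<open>p\<close> has a constant term, so no product
    of their terms has degree one.\<close>
  define h where "h = g - Poly_Mapping.single 0 (Poly_Mapping.lookup g 0)"
  have h0: "Poly_Mapping.lookup h 0 = 0" by (simp add: h_def lookup_minus)
  have "Poly_Mapping.lookup (h * p) (Poly_Mapping.single j 1) = 0"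
  proof (rule ccontr)
    assume "\<not> ?thesis"
    then have "Poly_Mapping.single j 1 \<in> Poly_Mapping.keys (h * p)" by (simp add: in_keys_iff)
    then obtain a b where ab: "Poly_Mapping.single j 1 = a + b"
        "a \<in> Poly_Mapping.keys h" "b \<in> Poly_Mapping.keys p"
      using keys_mult[of h p] by blast
    have sum: "Poly_Mapping.lookup a i + Poly_Mapping.lookup b i = (if i = j then 1 else 0)" for i
      using arg_cong[OF ab(1), of "\<lambda>u. Poly_Mapping.lookup u i"]
      by (auto simp: lookup_add lookup_single when_def split: if_splits)
    have "a = 0 \<or> b = 0"
    proof (cases "Poly_Mapping.lookup a j = 0")
      case True
      have "Poly_Mapping.lookup a i = 0" for i
        using sum[of i] True by (cases "i = j") auto
      then show ?thesis by (auto intro: poly_mapping_eqI)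
    next
      case False
      have "Poly_Mapping.lookup b i = 0" for i
        using sum[of i] False by (cases "i = j") auto
      then show ?thesis by (auto intro: poly_mapping_eqI)
    qed
    with ab h0 p show False by (auto simp: in_keys_iff)
  qed
  moreover have "g * p = Poly_Mapping.single 0 (Poly_Mapping.lookup g 0) * p + h * p"
    by (simp add: h_def algebra_simps)
  ultimately show ?thesis by (simp add: lookup_add lookup_single_zero_mult)
qed

text \<open>Reduces ideal membership to linear algebra: multipliers act on the linear parts of the
  generators through their constant terms alone, so no linear part outside \<open>V\<close> can
  arise.\<close>

lemma linear_form_in_ideal_iff:
  assumes V: "vec.subspace V" and gen: "vec.span (range r) = V"
  shows "linear_form v \<in> ideal.span (range (\<lambda>i. linear_form (r i))) \<longleftrightarrow> v \<in> V"
    (is "_ \<in> ?I \<longleftrightarrow> _")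
proof
  define lin :: "'a cpoly \<Rightarrow> complex ^ 'a"
    where "lin p = (\<chi> j. Poly_Mapping.lookup p (Poly_Mapping.single j 1))" for p
  \<comment> \<open>The vanishing constant term makes \<open>lin_mult\<close> applicable, so that
    \<open>?S\<close> is closed under ring multiplication.\<close>
  let ?S = "{p. Poly_Mapping.lookup p 0 = 0 \<and> lin p \<in> V}"
  have lin_add: "lin (p + q) = lin p + lin q" for p q
    by (simp add: lin_def vec_eq_iff lookup_add)
  have lin_0: "lin 0 = 0" by (simp add: lin_def vec_eq_iff)
  have lin_mult: "lin (g * p) = Poly_Mapping.lookup g 0 *s lin p"
    if "Poly_Mapping.lookup p 0 = 0" for g p
    by (simp add: lin_def vec_eq_iff lookup_mult_single_one[OF that] del: One_nat_def)
  have lin_linear_form: "lin (linear_form a) = a" for a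
    by (simp add: lin_def vec_eq_iff del: One_nat_def)
  have "ideal.subspace ?S"
    unfolding ideal.subspace_def
    using V by (auto simp: lin_add lin_0 lin_mult lookup_add lookup_mult_zero
        vec.subspace_0 vec.subspace_add vec.subspace_scale)
  moreover have "range (\<lambda>i. linear_form (r i)) \<subseteq> ?S"
    using gen by (auto simp: lin_linear_form intro: vec.span_base)
  ultimately have "?I \<subseteq> ?S" by (intro ideal.span_minimal)
  then show "linear_form v \<in> ?I \<Longrightarrow> v \<in> V"
    using lin_linear_form by auto
  have "vec.subspace {a. linear_form a \<in> ?I}"
    unfolding vec.subspace_def
    by (auto simp: linear_form_add linear_form_scale ideal.span_add ideal.span_scale)
      (simp add: linear_form_def ideal.span_zero)
  moreover have "range r \<subseteq> {a. linear_form a \<in> ?I}"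
    by (auto intro: ideal.span_base)
  ultimately have "V \<subseteq> {a. linear_form a \<in> ?I}"
    unfolding gen[symmetric] by (intro vec.span_minimal)
  then show "v \<in> V \<Longrightarrow> linear_form v \<in> ?I" by auto
qed

section \<open>Initial forms at indicator weights\<close>

lemma keys_sum_single:
  assumes "finite S" "S \<subseteq> Poly_Mapping.keys f"
  shows "Poly_Mapping.keys (\<Sum>u\<in>S. Poly_Mapping.single u (Poly_Mapping.lookup f u)) = S"
  using assms by (auto simp: in_keys_iff lookup_sum lookup_single when_def split: if_splits)

lemma keys_initial_form:
  "Poly_Mapping.keys (initial_form w f) =
     {u \<in> Poly_Mapping.keys f. \<forall>v \<in> Poly_Mapping.keys f. weight w u \<le> weight w v}"
  unfolding initial_form_def by (rule keys_sum_single) auto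

lemma is_monomial_iff: "is_monomial f \<longleftrightarrow> is_singleton (Poly_Mapping.keys f)"
proof
  assume "is_singleton (Poly_Mapping.keys f)"
  then obtain u where u: "Poly_Mapping.keys f = {u}" by (auto simp: is_singleton_def)
  have "f = Poly_Mapping.single u (Poly_Mapping.lookup f u)"
    by (rule poly_mapping_eqI) (use u in \<open>auto simp: lookup_single when_def in_keys_iff\<close>)
  moreover have "Poly_Mapping.lookup f u \<noteq> 0"
    using u by (metis in_keys_iff singletonI)
  ultimately show "is_monomial f" unfolding is_monomial_def by blast
qed (auto simp: is_monomial_def is_singleton_def)

text \<open>Once the support meets \<open>K\<close>, the minimal weight is 0 and exactly the terms
  indexed by \<open>K\<close> survive. A support missing \<open>K\<close> would leave the whole
  form, possibly a monomial; the assumption excludes this.\<close>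

lemma is_monomial_initial_linear_form_iff:
  assumes "\<exists>j\<in>K. v $ j \<noteq> 0"
  shows "is_monomial (initial_form (\<chi> j. if j \<in> K then 0 else 1) (linear_form v)) \<longleftrightarrow>
         (\<exists>k. {j \<in> K. v $ j \<noteq> 0} = {k})"
proof -
  let ?w = "\<chi> j. if j \<in> K then 0 else (1::real)"
  have "Poly_Mapping.keys (initial_form ?w (linear_form v)) =
      (\<lambda>j. Poly_Mapping.single j 1) ` {j \<in> K. v $ j \<noteq> 0}"
    using assms unfolding keys_initial_form keys_linear_form
    by (auto simp del: One_nat_def split: if_splits)
  moreover have "inj (\<lambda>j::'a. Poly_Mapping.single j (1::nat))"
    by (simp add: inj_def single_one_eq_iff del: One_nat_def)
  ultimately show ?thesis
    unfolding is_monomial_iff is_singleton_altdef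
    by (simp add: card_image inj_on_subset card_1_singleton_iff del: One_nat_def)
      (simp add: card_1_singleton_iff)
qed

section \<open>Value vectors of polynomials\<close>

text \<open>For distinct points \<open>t\<close> and polynomials of bounded degree these are the
  words of a Reed-Solomon code, the row space of a Vandermonde matrix.\<close>

definition values_vec :: "('n \<Rightarrow> 'a) \<Rightarrow> 'a::comm_semiring_0 poly \<Rightarrow> 'a ^ 'n" where
  "values_vec t p = (\<chi> j. poly p (t j))"

lemma values_vec_nth [simp]: "values_vec t p $ j = poly p (t j)"
  by (simp add: values_vec_def)

lemma card_zeros_less:
  fixes p :: "'a::{comm_ring_1,ring_no_zero_divisors} poly" and t :: "'n::finite \<Rightarrow> 'a"
  assumes "inj t" "p \<noteq> 0" "degree p < d"
  shows "card {j. poly p (t j) = 0} < d"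
proof -
  have "card {j. poly p (t j) = 0} = card (t ` {j. poly p (t j) = 0})"
    using assms(1) by (metis card_image inj_on_subset subset_UNIV)
  also have "\<dots> \<le> card {x. poly p x = 0}"
    using assms(2) by (intro card_mono poly_roots_finite) auto
  also have "\<dots> \<le> degree p" by (rule card_poly_roots_bound) (fact assms(2))
  finally show ?thesis using assms(3) by simp
qed

lemma subspace_values_vec:
  assumes "0 < d"
  shows "vec.subspace (values_vec (t :: 'n::finite \<Rightarrow> 'a::field) ` {p. degree p < d})"
  unfolding vec.subspace_def
proof (intro conjI ballI allI; (elim imageE)?)
  \<comment> \<open>The zero polynomial has \<open>degree\<close> 0 by convention, so it meets the
    bound because \<open>0 < d\<close>.\<close>
  show "0 \<in> values_vec t ` {p. degree p < d}"
    using assms by (intro image_eqI[of _ _ 0]) (auto simp: vec_eq_iff)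
next
  fix x y p q
  assume "x = values_vec t p" "p \<in> {p. degree p < d}" "y = values_vec t q" "q \<in> {p. degree p < d}"
  then show "x + y \<in> values_vec t ` {p. degree p < d}"
    by (intro image_eqI[of _ _ "p + q"]) (auto simp: vec_eq_iff degree_add_less)
next
  fix c x p
  assume "x = values_vec t p" "p \<in> {p. degree p < d}"
  then show "c *s x \<in> values_vec t ` {p. degree p < d}"
    by (intro image_eqI[of _ _ "smult c p"])
      (auto simp: vec_eq_iff intro: le_less_trans[OF degree_smult_le])
qed

text \<open>Expansion in monomials, padded with zero coefficients up to \<open>d - 1\<close>;
  \<open>e\<close> labels the exponents by the row index type.\<close>

lemma values_vec_eq_sum:
  fixes t :: "'n::finite \<Rightarrow> 'a::field"
  assumes "degree p < d" and e: "bij_betw e (UNIV :: 'd::finite set) {..<d}"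
  shows "values_vec t p = (\<Sum>i\<in>UNIV. coeff p (e i) *s values_vec t (monom 1 (e i)))"
proof -
  have "poly p x = (\<Sum>i\<in>UNIV. coeff p (e i) * x ^ e i)" for x
  proof -
    have "poly p x = (\<Sum>m<d. coeff p m * x ^ m)"
      unfolding poly_altdef using assms(1)
      by (intro sum.mono_neutral_left) (auto simp: coeff_eq_0)
    also have "\<dots> = (\<Sum>i\<in>UNIV. coeff p (e i) * x ^ e i)"
      by (rule sum.reindex_bij_betw[OF e, symmetric])
    finally show ?thesis .
  qed
  then show ?thesis by (simp add: vec_eq_iff poly_monom)
qed

lemma span_values_vec_monom:
  fixes t :: "'n::finite \<Rightarrow> 'a::field"
  assumes e: "bij_betw e (UNIV :: 'd::finite set) {..<d}"
  shows "vec.span (range (\<lambda>i. values_vec t (monom 1 (e i)))) = values_vec t ` {p. degree p < d}"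
proof (intro equalityI vec.span_minimal subspace_values_vec)
  have lt: "e i < d" for i using e by (auto simp: bij_betw_def)
  then show "range (\<lambda>i. values_vec t (monom 1 (e i))) \<subseteq> values_vec t ` {p. degree p < d}"
    by (auto simp: degree_monom_eq)
  show "0 < d" using lt by fastforce
  show "values_vec t ` {p. degree p < d} \<subseteq> vec.span (range (\<lambda>i. values_vec t (monom 1 (e i))))"
  proof clarify
    fix p :: "'a poly" assume "degree p < d"
    then show "values_vec t p \<in> vec.span (range (\<lambda>i. values_vec t (monom 1 (e i))))"
      by (subst values_vec_eq_sum[OF _ e])
        (auto intro: vec.span_sum vec.span_scale vec.span_base)
  qed
qed

lemma values_vec_eq_0_iff:
  fixes t :: "'n::finite \<Rightarrow> 'a::field"
  assumes "inj t" "degree p < d" "d \<le> CARD('n)"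
  shows "values_vec t p = 0 \<longleftrightarrow> p = 0"
proof
  assume "values_vec t p = 0"
  then have "{j. poly p (t j) = 0} = UNIV" by (auto simp: vec_eq_iff)
  then show "p = 0"
    using card_zeros_less[OF assms(1) _ assms(2)] assms(3) by fastforce
qed (simp add: vec_eq_iff)

text \<open>A linear relation among the rows is a polynomial of degree below \<open>d\<close>
  vanishing at at least \<open>d\<close> points. It is zero, and its coefficients are those of the
  relation.\<close>

lemma rank_vandermonde:
  fixes t :: "'n::finite \<Rightarrow> 'a::field"
  assumes t: "inj t" and e: "bij_betw e (UNIV :: 'd::finite set) {..<d}" and d: "d \<le> CARD('n)"
  shows "rank (\<chi> i. values_vec t (monom 1 (e i))) = d"
proof -
  let ?r = "\<lambda>i. values_vec t (monom 1 (e i))"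
  have lt: "e i < d" for i using e by (auto simp: bij_betw_def)
  then have "0 < d" by fastforce
  have ind: "c = (\<lambda>_. 0)" if sum0: "(\<Sum>i\<in>UNIV. c i *s ?r i) = 0" for c
  proof -
    define p where "p = (\<Sum>i\<in>UNIV. monom (c i) (e i))"
    have "degree p < d"
      unfolding p_def using lt \<open>0 < d\<close>
      by (intro degree_sum_less) (auto intro: le_less_trans[OF degree_monom_le])
    moreover have "values_vec t p = 0"
      using sum0 by (simp add: p_def vec_eq_iff poly_sum poly_monom)
    ultimately have "p = 0" using values_vec_eq_0_iff t d by blast
    have "c i = 0" for i
    proof -
      have "inj e" using e by (simp add: bij_betw_def)
      then have "coeff p (e i) = c i"
        by (simp add: p_def coeff_sum coeff_monom inj_eq)
      then show ?thesis using \<open>p = 0\<close> by simp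
    qed
    then show ?thesis by auto
  qed
  \<comment> \<open>Independence concerns the set of rows, so equal rows must be ruled out
    separately: they would give a relation with coefficients 1 and -1.\<close>
  have inj: "inj ?r"
  proof (rule injI, rule ccontr)
    fix i k assume "?r i = ?r k" and ne: "i \<noteq> k"
    let ?c = "\<lambda>m. if m = i then 1 else if m = k then - 1 else (0::'a)"
    have "(\<Sum>m\<in>UNIV. ?c m *s ?r m) = (\<Sum>m\<in>{i, k}. ?c m *s ?r m)"
      by (rule sum.mono_neutral_right) auto
    also have "\<dots> = 0" using ne \<open>?r i = ?r k\<close> by (simp add: vec_eq_iff)
    finally have "?c = (\<lambda>_. 0)" by (rule ind)
    then show False by (metis one_neq_zero)
  qed
  have "vec.independent (range ?r)"
    unfolding vec.dependent_finite[OF finite_imageI[OF finite]]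
  proof safe
    fix u i assume "(\<Sum>v\<in>range ?r. u v *s v) = 0" "u (?r i) \<noteq> 0"
    then have "(\<Sum>i\<in>UNIV. u (?r i) *s ?r i) = 0"
      by (simp add: sum.reindex[OF inj])
    from ind[OF this] \<open>u (?r i) \<noteq> 0\<close> show False by (simp add: fun_eq_iff)
  qed
  then have "vec.dim (range ?r) = card (range ?r)"
    by (rule vec.dim_eq_card_independent)
  also have "\<dots> = d"
    using inj bij_betw_same_card[OF e] by (simp add: card_image)
  also have "range ?r = rows (\<chi> i. ?r i)"
    by (simp add: rows_def row_def full_SetCompr_eq vec_lambda_eta del: values_vec_nth)
  finally show ?thesis by (simp add: row_rank_def_gen)
qed

section \<open>The size of a linear tropical basis\<close>

text \<open>The \<open>d - 1\<close> indices of \<open>K\<close> other than \<open>k\<close> are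
  zeros, and a nonzero polynomial of degree below \<open>d\<close> has no room for further
  ones.\<close>

lemma values_vec_unique_nonzero:
  fixes t :: "'n::finite \<Rightarrow> 'a::field"
  assumes t: "inj t" and p: "degree p < d" and K: "card K = d" and k: "{j \<in> K. poly p (t j) \<noteq> 0} = {k}"
  shows "K = insert k {j. poly p (t j) = 0}" "card {j. poly p (t j) = 0} = d - 1"
proof -
  let ?Z = "{j. poly p (t j) = 0}"
  have "k \<in> K" "k \<notin> ?Z" and sub: "K - {k} \<subseteq> ?Z" using k by auto
  then have "p \<noteq> 0" by auto
  then have "card ?Z < d" using card_zeros_less t p by blast
  moreover have "card (K - {k}) = d - 1" using \<open>k \<in> K\<close> K by simp
  ultimately have "K - {k} = ?Z" using sub by (intro card_seteq) auto
  then show "K = insert k ?Z" using \<open>k \<in> K\<close> by blast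
  show "card ?Z = d - 1" using \<open>K - {k} = ?Z\<close> \<open>card (K - {k}) = d - 1\<close> by simp
qed

text \<open>The zero set is fixed by \<open>p\<close>, so each such \<open>K\<close> is determined
  by its one index outside the zero set, with \<open>CARD('n) - (d - 1)\<close> choices.\<close>

lemma card_sets_unique_nonzero_le:
  fixes t :: "'n::finite \<Rightarrow> 'a::field"
  assumes "inj t" "degree p < d" "d \<le> CARD('n)"
  shows "card {K. card K = d \<and> (\<exists>k. {j \<in> K. poly p (t j) \<noteq> 0} = {k})} \<le> CARD('n) - d + 1"
    (is "card ?G \<le> _")
proof (cases "?G = {}")
  case False
  let ?Z = "{j. poly p (t j) = 0}"
  have Z: "card ?Z = d - 1"
    using False values_vec_unique_nonzero(2)[OF assms(1,2)] by blast
  have "?G \<subseteq> (\<lambda>k. insert k ?Z) ` (- ?Z)"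
  proof
    fix K assume "K \<in> ?G"
    then obtain k where "card K = d" "{j \<in> K. poly p (t j) \<noteq> 0} = {k}" by auto
    then show "K \<in> (\<lambda>k. insert k ?Z) ` (- ?Z)"
      using values_vec_unique_nonzero(1)[OF assms(1,2)] by (intro image_eqI[of _ _ k]) auto
  qed
  then have "card ?G \<le> card (- ?Z)" by (rule surj_card_le[rotated]) simp
  also have "\<dots> = CARD('n) - (d - 1)" by (simp add: Compl_eq_Diff_UNIV card_Diff_subset Z)
  finally show ?thesis using assms(2,3) by simp
next
  case True
  then show ?thesis by (metis card.empty le0)
qed

lemma exists_values_vec_unique_nonzero:
  fixes t :: "'n::finite \<Rightarrow> 'a::field"
  assumes "inj t" "card K = d" "0 < d"
  shows "\<exists>p k. degree p < d \<and> {j \<in> K. poly p (t j) \<noteq> 0} = {k}"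
proof -
  obtain k where "k \<in> K" using assms by fastforce
  \<comment> \<open>An unnormalised Lagrange basis polynomial, of degree
    \<open>d - 1\<close>.\<close>
  define p where "p = (\<Prod>j\<in>K - {k}. [:- t j, 1:])"
  have "degree p \<le> (\<Sum>j\<in>K - {k}. degree [:- t j, 1:])"
    unfolding p_def by (rule order_trans[OF degree_prod_sum_le]) (simp_all add: o_def)
  also have "\<dots> < d" using \<open>k \<in> K\<close> assms by simp
  finally have "degree p < d" .
  moreover have "{j \<in> K. poly p (t j) \<noteq> 0} = {k}"
    using \<open>k \<in> K\<close> assms(1) by (auto simp: p_def poly_prod inj_eq)
  ultimately show ?thesis by blast
qed

lemma tropical_basis_card_ge:
  fixes t :: "'n::finite \<Rightarrow> complex" and I :: "'n cpoly set"
  assumes t: "inj t" and d: "0 < d" "d \<le> CARD('n)"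
    and I: "\<And>v. linear_form v \<in> I \<longleftrightarrow> v \<in> values_vec t ` {p. degree p < d}"
    and F: "is_tropical_basis I F" "F \<subseteq> I \<inter> range linear_form"
  shows "CARD('n) choose d \<le> card F * (CARD('n) - d + 1)"
proof -
  define w :: "'n set \<Rightarrow> real ^ 'n" where "w K = (\<chi> j. if j \<in> K then 0 else 1)" for K
  \<comment> \<open>\<open>G f\<close> records the sets \<open>K\<close> whose weight
    \<open>w K\<close> is excluded by \<open>f\<close>; the bound follows by covering all
    \<open>d\<close>-subsets with these families.\<close>
  define G where "G f = {K. card K = d \<and> is_monomial (initial_form (w K) f)}" for f :: "'n cpoly"
  have "finite F" and var: "tropical_variety I = (\<Inter>f\<in>F. tropical_hypersurface f)"
    using F(1) by (auto simp: is_tropical_basis_def)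
  have mono_iff: "is_monomial (initial_form (w K) (linear_form (values_vec t p))) \<longleftrightarrow>
      (\<exists>k. {j \<in> K. poly p (t j) \<noteq> 0} = {k})"
    if "card K = d" "degree p < d" for K p
  proof (cases "p = 0")
    case True
    then have "linear_form (values_vec t p) = 0"
      by (simp add: linear_form_def)
    then have "\<not> is_monomial (initial_form (w K) (linear_form (values_vec t p)))"
      by (simp add: is_monomial_iff keys_initial_form is_singleton_def)
    then show ?thesis using True by simp
  next
    case False
    \<comment> \<open>A \<open>d\<close>-set cannot fit into a zero set with fewer than
      \<open>d\<close> elements, so the support meets \<open>K\<close>.\<close>
    have "\<not> K \<subseteq> {j. poly p (t j) = 0}"
      using card_zeros_less[OF t False that(2)] that(1)
      by (metis card_mono finite linorder_not_le)
    then have "\<exists>j\<in>K. values_vec t p $ j \<noteq> 0" by auto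
    from is_monomial_initial_linear_form_iff[OF this] show ?thesis by (simp add: w_def)
  qed
  have G_le: "card (G f) \<le> CARD('n) - d + 1" if "f \<in> F" for f
  proof -
    obtain v where "f = linear_form v" "linear_form v \<in> I" using \<open>f \<in> F\<close> F(2) by blast
    then obtain p where f: "f = linear_form (values_vec t p)" and p: "degree p < d"
      using I by auto
    have "G f = {K. card K = d \<and> (\<exists>k. {j \<in> K. poly p (t j) \<noteq> 0} = {k})}"
      unfolding G_def f using mono_iff[OF _ p] by blast
    then show ?thesis using card_sets_unique_nonzero_le[OF t p d(2)] by simp
  qed
  have "{K. card K = d} \<subseteq> (\<Union>f\<in>F. G f)"
  proof
    fix K :: "'n set" assume "K \<in> {K. card K = d}"
    then have K: "card K = d" by simp
    obtain p k where p: "degree p < d" "{j \<in> K. poly p (t j) \<noteq> 0} = {k}"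
      using exists_values_vec_unique_nonzero[OF t K d(1)] by blast
    have "linear_form (values_vec t p) \<in> I" using p(1) by (auto simp: I)
    moreover have "w K \<notin> tropical_hypersurface (linear_form (values_vec t p))"
      using mono_iff[OF K p(1)] p(2) by (auto simp: tropical_hypersurface_def)
    ultimately have "w K \<notin> tropical_variety I" by (auto simp: tropical_variety_def)
    then obtain f where "f \<in> F" "w K \<notin> tropical_hypersurface f" using var by auto
    then show "K \<in> (\<Union>f\<in>F. G f)" using K by (auto simp: tropical_hypersurface_def G_def)
  qed
  then have "card {K :: 'n set. card K = d} \<le> card (\<Union>f\<in>F. G f)"
    by (intro card_mono) auto
  also have "\<dots> \<le> (\<Sum>f\<in>F. card (G f))" by (rule card_UN_le[OF \<open>finite F\<close>])
  also have "\<dots> \<le> (\<Sum>f\<in>F. CARD('n) - d + 1)" by (intro sum_mono G_le)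
  finally show ?thesis using n_subsets[of "UNIV :: 'n set" d] by simp
qed

theorem theorem2p10:
  fixes d n :: nat
  assumes "CARD('d::finite) = d" and "CARD('n::finite) = n"
    and "1 \<le> d" and "d \<le> n"
  shows "\<exists>(A :: int ^ 'n ^ 'd) (I :: 'n cpoly set).
           rank (map_matrix complex_of_int A) = d \<and>
           I = ideal.span (range (\<lambda>i. linear_form (map_matrix complex_of_int A $ i))) \<and>
           (\<forall>F. is_tropical_basis I F \<and> F \<subseteq> I \<inter> range linear_form \<longrightarrow>
                real (card F) \<ge> 1 / (real n - real d + 1) * real (n choose d))"
proof -
  obtain e :: "'d \<Rightarrow> nat" where e: "bij_betw e UNIV {..<d}"
    using ex_bij_betw_finite_nat[of "UNIV :: 'd set"] assms(1) by (auto simp: atLeast0LessThan)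
  obtain s :: "'n \<Rightarrow> nat" where s: "inj s"
    using finite_imp_inj_to_nat_seg[of "UNIV :: 'n set"] by auto
  \<comment> \<open>Natural numbers as points keep the matrix integral, and characteristic 0 keeps
    them distinct in the complex numbers.\<close>
  define t :: "'n \<Rightarrow> complex" where "t j = of_nat (s j)" for j
  have t: "inj t" using s by (auto simp: t_def inj_def)
  \<comment> \<open>A Vandermonde matrix; if some \<open>s j\<close> is 0, the convention
    \<open>0 ^ 0 = 1\<close> agrees with evaluating the constant monomial.\<close>
  define A :: "int ^ 'n ^ 'd" where "A = (\<chi> i j. int (s j) ^ e i)"
  have row: "map_matrix complex_of_int A $ i = values_vec t (monom 1 (e i))" for i
    by (simp add: vec_eq_iff A_def t_def map_matrix_def poly_monom)
  then have A: "map_matrix complex_of_int A = (\<chi> i. values_vec t (monom 1 (e i)))"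
    by (simp add: vec_eq_iff)
  define I where "I = ideal.span (range (\<lambda>i. linear_form (map_matrix complex_of_int A $ i)))"
  have I: "linear_form v \<in> I \<longleftrightarrow> v \<in> values_vec t ` {p. degree p < d}" for v
    unfolding I_def row using assms(3)
    by (intro linear_form_in_ideal_iff subspace_values_vec span_values_vec_monom e) simp
  have "real (card F) \<ge> 1 / (real n - real d + 1) * real (n choose d)"
    if "is_tropical_basis I F" "F \<subseteq> I \<inter> range linear_form" for F
  proof -
    have "n choose d \<le> card F * (n - d + 1)"
      using tropical_basis_card_ge[OF t _ _ I that] assms by simp
    then have "real (n choose d) \<le> real (card F) * real (n - d + 1)"
      by (metis of_nat_le_iff of_nat_mult)
    \<comment> \<open>The natural-number subtraction is exact because
      \<open>d \<le> n\<close>.\<close>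
    also have "real (n - d + 1) = real n - real d + 1"
      using assms(4) by (simp add: of_nat_diff)
    finally show ?thesis using assms(4) by (simp add: pos_divide_le_eq)
  qed
  moreover have "rank (map_matrix complex_of_int A) = d"
    unfolding A using rank_vandermonde[OF t e] assms by simp
  ultimately show ?thesis using I_def by blast
qed

end
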